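(* Let $\epsilon_2\ge 0$, let $\mathcal{M}'=\langle S,L,\tau_\epsilon,\ell\rangle$ be a labelled Markov chain and let $\mathcal{Q}$ be an $\epsilon_2$-quotient of $\mathcal{M}'$. For $s\in S$ let $[s]^{\epsilon_2}_{\mathcal{Q}}$ be the state of $\mathcal{Q}$ corresponding to $s$. Then in the direct sum $\mathcal{M}'\oplus\mathcal{Q}$ we have $s\sim_{\frac{\epsilon_2}{2}}[s]^{\epsilon_2}_{\mathcal{Q}}$ for all $s\in S$.
   Context: A labelled Markov chain (LMC) is a quadruple $\langle S,L,\tau,\ell\rangle$ with $S$ a nonempty finite set of states, $L$ a nonempty finite set of labels, $\tau:S\to\mathrm{Distr}(S)$ a transition function ($\mathrm{Distr}(S)$ is the set of probability distributions on $S$), and $\ell:S\to L$ a labelling function. For $E\subseteq S$ write $\tau(s)(E)=\sum_{t\in E}\tau(s)(t)$. The direct sum $\mathcal{M}_1\oplus\mathcal{M}_2$ is the LMC on the disjoint union of the state spaces, each state keeping its label and transitions. An equivalence relation $\mathcal{R}\subseteq S\times S$ is a probabilistic bisimulation if for all $(s,t)\in\mathcal{R}$ we have $\ell(s)=\ell(t)$ and $\tau(s)(E)=\tau(t)(E)$ for each $\mathcal{R}$-equivalence class $E$. Probabilistic bisimilarity $\sim_{\mathcal{M}}$ is the largest probabilistic bisimulation on $\mathcal{M}$. A probabilistic bisimulation $\mathcal{R}$ induces the quotient LMC $\mathcal{M}/_{\mathcal{R}}=\langle S/_{\mathcal{R}},L,\tau/_{\mathcal{R}},\ell/_{\mathcal{R}}\rangle$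 with $\tau/_{\mathcal{R}}([s])([t])=\tau(s)([t])$ and $\ell/_{\mathcal{R}}([s])=\ell(s)$. For $\epsilon\ge 0$, an LMC $\mathcal{Q}$ is an $\epsilon$-quotient of $\mathcal{M}=\langle S,L,\tau,\ell\rangle$ if there is a transition function $\tau':S\to\mathrm{Distr}(S)$ with $\|\tau'(s)-\tau(s)\|_1\le\epsilon$ for all $s\in S$ such that $\mathcal{Q}$ is (up to isomorphism, i.e. renaming of states) the bisimulation quotient $\mathcal{N}/_{\sim_{\mathcal{N}}}$ of $\mathcal{N}=\langle S,L,\tau',\ell\rangle$. For $s\in S$, $[s]^{\epsilon}_{\mathcal{Q}}$ denotes the state of $\mathcal{Q}$ corresponding to $s$, i.e. to the $\sim_{\mathcal{N}}$-class of $s$, for the given witness $\tau'$. Couplings: for $\mu,\nu\in\mathrm{Distr}(S)$, $\Omega(\mu,\nu)$ is the set of $\omega\in\mathrm{Distr}(S\times S)$ with $\sum_t\omega(s,t)=\mu(s)$ and $\sum_s\omega(s,t)=\nu(t)$. For $\epsilon\ge 0$, a relation $\mathcal{R}\subseteq S\times S$ is an $\epsilon$-bisimulation if for all $(s,t)\in\mathcal{R}$ we have $\ell(s)=\ell(t)$ and there is $\omega\in\Omega(\tau(s),\tau(t))$ with $\sum_{(u,v)\in\mathcal{R}}\omega(u,v)\ge 1-\epsilon$. We write $s\sim_\epsilon t$ if some $\epsilon$-bisimulation contains $(s,t)$. *)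

theory Defs
  imports "HOL-Probability.Probability"
begin

record ('s, 'l) lmc =
  states :: "'s set"
  labels :: "'l set"
  transition :: "'s \<Rightarrow> 's pmf"
  label :: "'s \<Rightarrow> 'l"

text \<open>A distribution on a set \<open>S\<close> is a \<^type>\<open>pmf\<close> whose support lies in \<open>S\<close>. The fields
  \<open>transition\<close> and \<open>label\<close> are irrelevant outside the state space.\<close>

definition is_lmc :: "('s, 'l) lmc \<Rightarrow> bool" where
  "is_lmc M \<longleftrightarrow>
     finite (states M) \<and> states M \<noteq> {} \<and>
     finite (labels M) \<and> labels M \<noteq> {} \<and>
     (\<forall>s\<in>states M. set_pmf (transition M s) \<subseteq> states M) \<and>
     (\<forall>s\<in>states M. label M s \<in> labels M)"

definition direct_sum :: "('s, 'l) lmc \<Rightarrow> ('t, 'l) lmc \<Rightarrow> ('s + 't, 'l) lmc" where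
  "direct_sum M N =
     \<lparr> states = states M <+> states N,
       labels = labels M \<union> labels N,
       transition = case_sum (\<lambda>s. map_pmf Inl (transition M s)) (\<lambda>t. map_pmf Inr (transition N t)),
       label = case_sum (label M) (label N) \<rparr>"

definition prob_bisimulation :: "('s, 'l) lmc \<Rightarrow> 's rel \<Rightarrow> bool" where
  "prob_bisimulation M R \<longleftrightarrow>
     equiv (states M) R \<and>
     (\<forall>(s, t)\<in>R. label M s = label M t \<and>
        (\<forall>E\<in>states M // R.
           measure_pmf.prob (transition M s) E = measure_pmf.prob (transition M t) E))"

definition prob_bisimilarity :: "('s, 'l) lmc \<Rightarrow> 's rel" where
  "prob_bisimilarity M = \<Union>{R. prob_bisimulation M R}"

text \<open>The choice of representatives is immaterial when \<open>R\<close> is a probabilistic bisimulation; see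
  \<open>label_quotient\<close> and \<open>transition_quotient\<close> below.\<close>

definition quotient_lmc :: "('s, 'l) lmc \<Rightarrow> 's rel \<Rightarrow> ('s set, 'l) lmc" where
  "quotient_lmc M R =
     \<lparr> states = states M // R,
       labels = labels M,
       transition = (\<lambda>C. map_pmf (\<lambda>t. R `` {t}) (transition M (SOME s. s \<in> C))),
       label = (\<lambda>C. label M (SOME s. s \<in> C)) \<rparr>"

definition lmc_isomorphism :: "('s, 'l) lmc \<Rightarrow> ('t, 'l) lmc \<Rightarrow> ('s \<Rightarrow> 't) \<Rightarrow> bool" where
  "lmc_isomorphism M N h \<longleftrightarrow>
     labels M = labels N \<and>
     bij_betw h (states M) (states N) \<and>
     (\<forall>s\<in>states M. label N (h s) = label M s \<and>
        transition N (h s) = map_pmf h (transition M s))"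

text \<open>\<open>Q\<close> is an \<open>\<epsilon>\<close>-quotient of \<open>M\<close>, as witnessed by the perturbed transition function \<open>\<tau>'\<close> and
  the renaming \<open>h\<close> of the bisimilarity classes to the states of \<open>Q\<close>.\<close>

definition eps_quotient_witness ::
  "real \<Rightarrow> ('s, 'l) lmc \<Rightarrow> ('q, 'l) lmc \<Rightarrow> ('s \<Rightarrow> 's pmf) \<Rightarrow> ('s set \<Rightarrow> 'q) \<Rightarrow> bool" where
  "eps_quotient_witness \<epsilon> M Q \<tau>' h \<longleftrightarrow>
     (\<forall>s\<in>states M. set_pmf (\<tau>' s) \<subseteq> states M \<and>
        (\<Sum>t\<in>states M. \<bar>pmf (\<tau>' s) t - pmf (transition M s) t\<bar>) \<le> \<epsilon>) \<and>
     (let N = M\<lparr>transition := \<tau>'\<rparr>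
      in lmc_isomorphism (quotient_lmc N (prob_bisimilarity N)) Q h)"

definition eps_quotient :: "real \<Rightarrow> ('s, 'l) lmc \<Rightarrow> ('q, 'l) lmc \<Rightarrow> bool" where
  "eps_quotient \<epsilon> M Q \<longleftrightarrow> (\<exists>\<tau>' h. eps_quotient_witness \<epsilon> M Q \<tau>' h)"

definition quotient_state ::
  "('s, 'l) lmc \<Rightarrow> ('s \<Rightarrow> 's pmf) \<Rightarrow> ('s set \<Rightarrow> 'q) \<Rightarrow> 's \<Rightarrow> 'q" where
  "quotient_state M \<tau>' h s = h (prob_bisimilarity (M\<lparr>transition := \<tau>'\<rparr>) `` {s})"

definition couplings :: "'s pmf \<Rightarrow> 's pmf \<Rightarrow> ('s \<times> 's) pmf set" where
  "couplings \<mu> \<nu> = {\<omega>. map_pmf fst \<omega> = \<mu> \<and> map_pmf snd \<omega> = \<nu>}"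

definition eps_bisimulation :: "real \<Rightarrow> ('s, 'l) lmc \<Rightarrow> 's rel \<Rightarrow> bool" where
  "eps_bisimulation \<epsilon> M R \<longleftrightarrow>
     R \<subseteq> states M \<times> states M \<and>
     (\<forall>(s, t)\<in>R. label M s = label M t \<and>
        (\<exists>\<omega>\<in>couplings (transition M s) (transition M t). measure_pmf.prob \<omega> R \<ge> 1 - \<epsilon>))"

definition eps_bisimilar :: "real \<Rightarrow> ('s, 'l) lmc \<Rightarrow> 's \<Rightarrow> 's \<Rightarrow> bool" where
  "eps_bisimilar \<epsilon> M s t \<longleftrightarrow> (\<exists>R. eps_bisimulation \<epsilon> M R \<and> (s, t) \<in> R)"

lemma prob_bisimulation_Id_on: "prob_bisimulation M (Id_on (states M))"
  by (auto simp: prob_bisimulation_def equiv_def refl_on_def sym_def trans_def)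

lemma prob_union_of_classes:
  assumes fin: "finite (states M)" and R: "prob_bisimulation M R" and st: "(s, t) \<in> R"
    and EF: "E \<subseteq> states M" and closed: "\<And>x y. x \<in> E \<Longrightarrow> (x, y) \<in> R \<Longrightarrow> y \<in> E"
  shows "measure_pmf.prob (transition M s) E = measure_pmf.prob (transition M t) E"
proof -
  have eq: "equiv (states M) R" using R by (simp add: prob_bisimulation_def)
  define K where "K = {C \<in> states M // R. C \<subseteq> E}"
  have finK: "finite K"
    using finite_quotient[OF fin, of R] eq by (simp add: K_def equiv_def)
  have EK: "E = \<Union>K"
  proof
    show "E \<subseteq> \<Union>K"
    proof
      fix x assume x: "x \<in> E"
      then have "R `` {x} \<in> K" using EF closed by (auto simp: K_def quotientI)
      moreover have "x \<in> R `` {x}" using x EF eq by (meson equiv_class_self subsetD)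
      ultimately show "x \<in> \<Union>K" by blast
    qed
  qed (auto simp: K_def)
  have disj: "disjoint_family_on (\<lambda>C. C) K"
    using quotient_disj[OF eq] by (fastforce simp: disjoint_family_on_def K_def)
  have sum: "measure_pmf.prob p E = (\<Sum>C\<in>K. measure_pmf.prob p C)" for p :: "'a pmf"
    unfolding EK using measure_pmf.finite_measure_finite_Union[OF finK _ disj, of p] by simp
  show ?thesis unfolding sum
    using R st by (intro sum.cong) (auto simp: prob_bisimulation_def K_def)
qed

theorem prob_bisimulation_prob_bisimilarity:
  assumes "finite (states M)"
  shows "prob_bisimulation M (prob_bisimilarity M)"
proof -
  let ?U = "prob_bisimilarity M"
  have Us: "?U \<subseteq> states M \<times> states M"
    unfolding prob_bisimilarity_def prob_bisimulation_def equiv_def by fast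
  have UI: "R \<subseteq> ?U" if "prob_bisimulation M R" for R
    using that by (auto simp: prob_bisimilarity_def)
  have "sym ?U"
    unfolding prob_bisimilarity_def
    by (rule symI) (auto simp: prob_bisimulation_def equiv_def dest: symD)
  then have eq: "equiv (states M) (?U\<^sup>+)"
    using UI[OF prob_bisimulation_Id_on] trancl_subset_Sigma[OF Us]
    by (intro equivI) (auto simp: refl_on_def intro: sym_trancl)
  have related: "label M s = label M t \<and> (\<forall>E\<in>states M // ?U\<^sup>+.
      measure_pmf.prob (transition M s) E = measure_pmf.prob (transition M t) E)"
    if st: "(s, t) \<in> ?U" for s t
  proof -
    obtain R where R: "prob_bisimulation M R" "(s, t) \<in> R"
      using st by (auto simp: prob_bisimilarity_def)
    have "measure_pmf.prob (transition M s) E = measure_pmf.prob (transition M t) E"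
      if E: "E \<in> states M // ?U\<^sup>+" for E
    proof (rule prob_union_of_classes[OF assms R])
      show "E \<subseteq> states M" using E eq by (metis Union_quotient Union_upper)
      show "y \<in> E" if "x \<in> E" "(x, y) \<in> R" for x y
        using that E UI[OF R(1)] by (auto simp: quotient_def intro: trancl_into_trancl)
    qed
    then show ?thesis using R by (auto simp: prob_bisimulation_def)
  qed
  have "label M s = label M t \<and> (\<forall>E\<in>states M // ?U\<^sup>+.
      measure_pmf.prob (transition M s) E = measure_pmf.prob (transition M t) E)"
    if "(s, t) \<in> ?U\<^sup>+" for s t
    using that
  proof (induction rule: trancl_induct)
    case (base t)
    then show ?case by (rule related)
  next
    case (step t u)
    then show ?case using \<open>(t, u) \<in> ?U\<close>[THEN related] by simp
  qed
  with eq have T: "prob_bisimulation M (?U\<^sup>+)" by (auto simp: prob_bisimulation_def)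
  have "?U\<^sup>+ = ?U" using UI[OF T] by auto
  with T show ?thesis by simp
qed

lemma prob_bisimilarity_greatest: "prob_bisimulation M R \<Longrightarrow> R \<subseteq> prob_bisimilarity M"
  by (auto simp: prob_bisimilarity_def)

lemma some_representative:
  assumes "prob_bisimulation M R" "s \<in> states M"
  shows "(s, SOME t. t \<in> R `` {s}) \<in> R"
  using someI[of "\<lambda>t. t \<in> R `` {s}" s] assms
  by (auto simp: prob_bisimulation_def dest: equiv_class_self)

lemma label_quotient:
  assumes "prob_bisimulation M R" "s \<in> states M"
  shows "label (quotient_lmc M R) (R `` {s}) = label M s"
  using some_representative[OF assms] assms(1)
  by (auto simp: quotient_lmc_def prob_bisimulation_def)

lemma transition_quotient:
  assumes M: "is_lmc M" and R: "prob_bisimulation M R" and s: "s \<in> states M" and t: "t \<in> states M"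
  shows "pmf (transition (quotient_lmc M R) (R `` {s})) (R `` {t})
       = measure_pmf.prob (transition M s) (R `` {t})"
proof -
  let ?r = "SOME t. t \<in> R `` {s}"
  have eq: "equiv (states M) R" using R by (simp add: prob_bisimulation_def)
  have sr: "(s, ?r) \<in> R" by (rule some_representative[OF R s])
  then have r: "?r \<in> states M" using eq by (auto simp: equiv_def)
  have "measure_pmf.prob (transition M ?r) ((\<lambda>u. R `` {u}) -` {R `` {t}})
      = measure_pmf.prob (transition M ?r) (R `` {t})"
  proof (rule measure_pmf.finite_measure_eq_AE)
    have "u \<in> (\<lambda>u. R `` {u}) -` {R `` {t}} \<longleftrightarrow> u \<in> R `` {t}"
      if "u \<in> set_pmf (transition M ?r)" for u
    proof -
      have "u \<in> states M" using that r M by (auto simp: is_lmc_def)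
      then show ?thesis using eq_equiv_class_iff[OF eq _ t, of u] eq
        by (auto simp: equiv_def dest: symD)
    qed
    then show "AE u in transition M ?r. (u \<in> (\<lambda>u. R `` {u}) -` {R `` {t}}) = (u \<in> R `` {t})"
      by (simp add: AE_measure_pmf_iff)
  qed auto
  also have "\<dots> = measure_pmf.prob (transition M s) (R `` {t})"
    using R sr t by (auto simp: prob_bisimulation_def quotientI)
  finally show ?thesis by (simp add: quotient_lmc_def pmf_map)
qed

lemma is_lmc_quotient:
  assumes M: "is_lmc M" and R: "prob_bisimulation M R"
  shows "is_lmc (quotient_lmc M R)"
proof -
  have eq: "equiv (states M) R" using R by (simp add: prob_bisimulation_def)
  have rep: "(SOME t. t \<in> C) \<in> states M" if "C \<in> states M // R" for C
    using that some_representative[OF R] eq by (fastforce simp: quotient_def equiv_def)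
  have "finite (states M // R)" using M eq by (auto simp: is_lmc_def equiv_def intro: finite_quotient)
  then show ?thesis
    using M rep by (fastforce simp: is_lmc_def quotient_lmc_def intro: quotientI)
qed

lemma is_lmc_isomorphic:
  assumes "is_lmc M" "lmc_isomorphism M N h"
  shows "is_lmc N"
proof -
  have N: "states N = h ` states M" using assms(2) by (auto simp: lmc_isomorphism_def bij_betw_def)
  have "set_pmf (transition N t) \<subseteq> states N" if t: "t \<in> states N" for t
  proof -
    obtain s where s: "s \<in> states M" "t = h s" using t N by blast
    then have "transition N t = map_pmf h (transition M s)"
      using assms(2) by (simp add: lmc_isomorphism_def)
    moreover have "set_pmf (transition M s) \<subseteq> states M" using assms(1) s by (simp add: is_lmc_def)
    ultimately show ?thesis unfolding N by auto
  qed
  moreover have "finite (states N)" "states N \<noteq> {}" "\<forall>t\<in>states N. label N t \<in> labels N"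
    using assms unfolding N by (auto simp: is_lmc_def lmc_isomorphism_def)
  ultimately show ?thesis using assms by (simp add: is_lmc_def lmc_isomorphism_def)
qed

theorem is_lmc_eps_quotient:
  assumes M: "is_lmc M" and Q: "eps_quotient \<epsilon> M Q"
  shows "is_lmc Q"
proof -
  obtain \<tau>' h where w: "eps_quotient_witness \<epsilon> M Q \<tau>' h" using Q by (auto simp: eps_quotient_def)
  let ?N = "M\<lparr>transition := \<tau>'\<rparr>"
  have "is_lmc ?N" using M w by (auto simp: is_lmc_def eps_quotient_witness_def)
  moreover from this have "prob_bisimulation ?N (prob_bisimilarity ?N)"
    by (intro prob_bisimulation_prob_bisimilarity) (simp add: is_lmc_def)
  ultimately show ?thesis
    using w is_lmc_isomorphic is_lmc_quotient by (fastforce simp: eps_quotient_witness_def Let_def)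
qed

lemma is_lmc_direct_sum: "is_lmc M \<Longrightarrow> is_lmc N \<Longrightarrow> is_lmc (direct_sum M N)"
  unfolding is_lmc_def direct_sum_def lmc.simps by (intro conjI) (auto simp: Plus_def subset_eq inj_image_mem_iff)

end

theory Submission
  imports Defs
begin

text \<open>Let \<open>\<tau>'\<close> be the perturbed transition function and \<open>g\<close> the map sending a state to the state
  of \<open>Q\<close> that represents it. The relation \<open>{(s, g s) | s}\<close> is an \<open>\<epsilon>/2\<close>-bisimulation: a maximal
  coupling of \<open>\<tau>(s)\<close> and \<open>\<tau>'(s)\<close> puts mass at least \<open>1 - \<epsilon>/2\<close> on the diagonal, and pushing its
  second component forward along \<open>g\<close> gives a coupling of \<open>\<tau>(s)\<close> with the distribution of \<open>g s\<close>
  in \<open>Q\<close>.\<close>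

text \<open>Expresses the marginals of a coupling with finite support as finite sums, where the row
  and column sums of its mass function can be read off.\<close>

lemma pmf_map_eq_sum:
  assumes "finite B" "set_pmf p \<subseteq> B"
  shows "pmf (map_pmf f p) x = (\<Sum>b\<in>B. if f b = x then pmf p b else 0)"
proof -
  have "pmf (map_pmf f p) x = measure_pmf.prob p (f -` {x} \<inter> set_pmf p)"
    by (simp add: pmf_map measure_Int_set_pmf)
  also have "f -` {x} \<inter> set_pmf p = {b \<in> B. f b = x} \<inter> set_pmf p"
    using assms(2) by auto
  also have "measure_pmf.prob p \<dots> = (\<Sum>b\<in>{b \<in> B. f b = x}. pmf p b)"
    using assms(1) by (simp add: measure_Int_set_pmf measure_measure_pmf_finite)
  finally show ?thesis using assms(1) by (simp add: sum.If_cases Int_def)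
qed

text \<open>The overlap \<open>m = min p q\<close>, of total mass \<open>d\<close>, goes on the
  diagonal. The residuals \<open>p - m\<close> and \<open>q - m\<close> both have mass
  \<open>1 - d\<close> and are coupled by their product, rescaled by \<open>1 / (1 - d)\<close>. The
  support bound lets the main proof conclude that diagonal pairs of positive mass consist of
  states.\<close>

theorem maximal_coupling:
  fixes p q :: "'a pmf"
  assumes A: "finite A" "set_pmf p \<subseteq> A" "set_pmf q \<subseteq> A"
  shows "\<exists>\<omega>\<in>couplings p q. set_pmf \<omega> \<subseteq> A \<times> A \<and>
    1 - (\<Sum>x\<in>A. \<bar>pmf q x - pmf p x\<bar>) / 2 \<le> measure_pmf.prob \<omega> {(x, y). x = y}"
proof -
  define m where "m x = min (pmf p x) (pmf q x)" for x
  define d where "d = (\<Sum>x\<in>A. m x)"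
  \<comment> \<open>For \<open>d = 1\<close> the quotient is \<open>x / 0 = 0\<close>, which is right since then \<open>p = m = q\<close>.\<close>
  define f where "f = (\<lambda>(x, y). (if x = y then m x else 0)
    + (pmf p x - m x) * (pmf q y - m y) / (1 - d))"
  have sums: "(\<Sum>x\<in>A. pmf p x) = 1" "(\<Sum>x\<in>A. pmf q x) = 1"
    using A by (auto intro: sum_pmf_eq_1)
  have m: "0 \<le> m x" "m x \<le> pmf p x" "m x \<le> pmf q x" for x
    by (auto simp: m_def)
  have rest: "(\<Sum>x\<in>A. pmf p x - m x) = 1 - d" "(\<Sum>x\<in>A. pmf q x - m x) = 1 - d"
    by (simp_all add: sum_subtractf sums d_def)
  have d1: "d \<le> 1"
    using sum_nonneg[of A "\<lambda>x. pmf p x - m x"] m rest by simp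
  \<comment> \<open>If \<open>d = 1\<close>, the residuals are nonnegative with sum 0, so they
    vanish on \<open>A\<close> and both sides are 0; otherwise the factor \<open>1 - d\<close>
    cancels.\<close>
  have cancel: "(pmf p x - m x) * (1 - d) / (1 - d) = pmf p x - m x"
    "(pmf q x - m x) * (1 - d) / (1 - d) = pmf q x - m x" if "x \<in> A" for x
    using sum_nonneg_eq_0_iff[OF A(1), of "\<lambda>x. pmf p x - m x"]
      sum_nonneg_eq_0_iff[OF A(1), of "\<lambda>x. pmf q x - m x"] m rest that
    by (cases "d = 1"; simp)+
  have zero: "pmf p x = 0" "pmf q x = 0" "m x = 0" if "x \<notin> A" for x
  proof -
    show "pmf p x = 0" "pmf q x = 0" using that A by (auto simp: set_pmf_eq)
    then show "m x = 0" by (simp add: m_def)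
  qed
  have f0: "0 \<le> f z" for z
    using m d1 by (auto simp: f_def split: prod.split)
  have row: "(\<Sum>y\<in>A. f (x, y)) = pmf p x" if "x \<in> A" for x
  proof -
    have "(\<Sum>y\<in>A. f (x, y)) = m x + (\<Sum>y\<in>A. (pmf p x - m x) * (pmf q y - m y) / (1 - d))"
      using A(1) that by (simp add: f_def sum.distrib)
    also have "\<dots> = pmf p x"
      using cancel(1)[OF that] by (simp add: rest flip: sum_divide_distrib sum_distrib_left)
    finally show ?thesis .
  qed
  have col: "(\<Sum>x\<in>A. f (x, y)) = pmf q y" if "y \<in> A" for y
  proof -
    have "(\<Sum>x\<in>A. f (x, y)) = m y + (\<Sum>x\<in>A. (pmf p x - m x) * (pmf q y - m y) / (1 - d))"
      using A(1) that by (simp add: f_def sum.distrib)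
    also have "\<dots> = pmf q y"
      using cancel(2)[OF that]
      by (simp add: rest mult.commute flip: sum_divide_distrib sum_distrib_right)
    finally show ?thesis .
  qed
  have f_out: "f z = 0" if "z \<notin> A \<times> A" for z
    using that zero by (cases z) (auto simp: f_def)
  have "(\<integral>\<^sup>+z. ennreal (f z) \<partial>count_space UNIV) = (\<Sum>z\<in>A \<times> A. ennreal (f z))"
    using A(1) f_out by (intro nn_integral_count_space') auto
  also have "\<dots> = ennreal (\<Sum>x\<in>A. \<Sum>y\<in>A. f (x, y))"
    using f0 by (simp add: sum_ennreal sum.cartesian_product)
  also have "\<dots> = 1" by (simp add: row sums)
  finally have total: "(\<integral>\<^sup>+z. ennreal (f z) \<partial>count_space UNIV) = 1" .
  define \<omega> where "\<omega> = embed_pmf f"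
  have pmf: "pmf \<omega> z = f z" for z
    unfolding \<omega>_def by (rule pmf_embed_pmf[OF f0 total])
  have supp: "set_pmf \<omega> \<subseteq> A \<times> A"
    using f_out by (auto simp: set_pmf_eq pmf)
  have marg: "pmf (map_pmf k \<omega>) a = (\<Sum>x\<in>A. \<Sum>y\<in>A. if k (x, y) = a then f (x, y) else 0)"
    for k :: "'a \<times> 'a \<Rightarrow> 'a" and a
    using pmf_map_eq_sum[OF _ supp, of k a] A(1) by (simp add: pmf sum.cartesian_product cong: if_cong)
  have "pmf (map_pmf fst \<omega>) a = pmf p a" for a
  proof -
    have "pmf (map_pmf fst \<omega>) a = (\<Sum>x\<in>A. if x = a then \<Sum>y\<in>A. f (x, y) else 0)"
      by (auto simp: marg intro: sum.cong)
    then show ?thesis using A(1) row zero by auto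
  qed
  moreover have "pmf (map_pmf snd \<omega>) a = pmf q a" for a
  proof -
    have "pmf (map_pmf snd \<omega>) a = (\<Sum>x\<in>A. if a \<in> A then f (x, a) else 0)"
      using A(1) by (auto simp: marg intro: sum.cong)
    then show ?thesis using col zero by (cases "a \<in> A") auto
  qed
  ultimately have coupling: "\<omega> \<in> couplings p q"
    by (auto simp: couplings_def intro: pmf_eqI)
  \<comment> \<open>The factor 1/2 arises here: a distance |a - b| is a + b - 2 min(a, b), so the L1
    distance is \<open>2 - 2 * d\<close>.\<close>
  have "(\<Sum>x\<in>A. \<bar>pmf q x - pmf p x\<bar>) = (\<Sum>x\<in>A. pmf p x + pmf q x - 2 * m x)"
    by (intro sum.cong) (auto simp: m_def)
  also have "\<dots> = 2 - 2 * d"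
    by (simp add: sum_subtractf sum.distrib sums d_def sum_distrib_left)
  finally have "1 - (\<Sum>x\<in>A. \<bar>pmf q x - pmf p x\<bar>) / 2 = d" by (simp add: diff_divide_distrib)
  \<comment> \<open>The product of the residuals adds a nonnegative amount to the overlap on the
    diagonal.\<close>
  also have "\<dots> \<le> (\<Sum>x\<in>A. f (x, x))"
    unfolding d_def using m d1 by (intro sum_mono) (simp add: f_def)
  also have "\<dots> = (\<Sum>z\<in>(\<lambda>x. (x, x)) ` A. pmf \<omega> z)"
    by (simp add: sum.reindex inj_on_def pmf)
  also have "\<dots> = measure_pmf.prob \<omega> ((\<lambda>x. (x, x)) ` A)"
    using A(1) by (simp add: measure_measure_pmf_finite)
  also have "\<dots> \<le> measure_pmf.prob \<omega> {(x, y). x = y}"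
    by (rule measure_pmf.finite_measure_mono) auto
  finally show ?thesis using coupling supp by blast
qed

text \<open>The quotient is defined through a chosen representative, but related states give every
  class the same mass, so \<open>s\<close> itself yields the same pushforward. An equality of
  distributions, rather than of masses of single classes, can be composed with the renaming of
  states.\<close>

lemma transition_quotient_eq_map:
  assumes M: "is_lmc M" and R: "prob_bisimulation M R" and s: "s \<in> states M"
  shows "transition (quotient_lmc M R) (R `` {s}) = map_pmf (\<lambda>t. R `` {t}) (transition M s)"
proof -
  have eq: "equiv (states M) R" using R by (simp add: prob_bisimulation_def)
  let ?r = "SOME t. t \<in> R `` {s}"
  have sr: "(s, ?r) \<in> R" by (rule some_representative[OF R s])
  then have r: "?r \<in> states M" using eq by (auto simp: equiv_def)
  \<comment> \<open>Extensionality ranges over all sets \<open>C\<close>. Within the support, the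
    fibre of the class map over a class is that class, and over any other set it is empty.\<close>
  have vimage: "pmf (map_pmf (\<lambda>t. R `` {t}) (transition M u)) C =
      (if C \<in> states M // R then measure_pmf.prob (transition M u) C else 0)"
    if u: "u \<in> states M" for u C
  proof -
    have supp: "set_pmf (transition M u) \<subseteq> states M" using M u by (simp add: is_lmc_def)
    have "(\<lambda>t. R `` {t}) -` {C} \<inter> set_pmf (transition M u) =
        (if C \<in> states M // R then C else {}) \<inter> set_pmf (transition M u)"
    proof (cases "C \<in> states M // R")
      case True
      have "R `` {t} = C \<longleftrightarrow> t \<in> C" if "t \<in> states M" for t
      proof
        show "t \<in> C" if "R `` {t} = C"
          using equiv_class_self[OF eq \<open>t \<in> states M\<close>] that by simp
        show "R `` {t} = C" if "t \<in> C"
          using True that equiv_class_eq[OF eq] by (force simp: quotient_def)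
      qed
      then show ?thesis using True supp by auto
    next
      case False
      then show ?thesis using supp by (auto simp: quotient_def)
    qed
    then have "measure_pmf.prob (transition M u) ((\<lambda>t. R `` {t}) -` {C}) =
        measure_pmf.prob (transition M u) (if C \<in> states M // R then C else {})"
      by (metis (no_types) measure_Int_set_pmf)
    then show ?thesis by (simp add: pmf_map)
  qed
  have "measure_pmf.prob (transition M ?r) C = measure_pmf.prob (transition M s) C"
    if "C \<in> states M // R" for C
    using R sr that unfolding prob_bisimulation_def by fastforce
  then have "map_pmf (\<lambda>t. R `` {t}) (transition M ?r) = map_pmf (\<lambda>t. R `` {t}) (transition M s)"
    by (intro pmf_eqI) (auto simp only: vimage[OF r] vimage[OF s] split: if_split)
  then show ?thesis by (simp add: quotient_lmc_def)
qed

theorem proposition2: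
  fixes \<epsilon>\<^sub>2 :: real
    and M' :: "('s, 'l) lmc"
    and Q :: "('q, 'l) lmc"
    and \<tau>' :: "'s \<Rightarrow> 's pmf"
    and h :: "'s set \<Rightarrow> 'q"
  assumes "\<epsilon>\<^sub>2 \<ge> 0"
    and "is_lmc M'"
    and "eps_quotient \<epsilon>\<^sub>2 M' Q"
    and "eps_quotient_witness \<epsilon>\<^sub>2 M' Q \<tau>' h"
  shows "\<forall>s\<in>states M'.
    eps_bisimilar (\<epsilon>\<^sub>2 / 2) (direct_sum M' Q) (Inl s) (Inr (quotient_state M' \<tau>' h s))"
proof -
  define N where "N = M'\<lparr>transition := \<tau>'\<rparr>"
  define U where "U = prob_bisimilarity N"
  define g where "g s = h (U `` {s})" for s
  define R :: "('s + 'q) rel" where "R = (\<lambda>s. (Inl s, Inr (g s))) ` states M'"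
  have g: "quotient_state M' \<tau>' h s = g s" for s
    by (simp add: quotient_state_def g_def U_def N_def)
  have fields: "states N = states M'" "label N = label M'" "transition N = \<tau>'"
    by (simp_all add: N_def)
  have fin: "finite (states M')" using assms(2) by (simp add: is_lmc_def)
  have w: "set_pmf (\<tau>' s) \<subseteq> states M'"
    "(\<Sum>t\<in>states M'. \<bar>pmf (\<tau>' s) t - pmf (transition M' s) t\<bar>) \<le> \<epsilon>\<^sub>2"
    if "s \<in> states M'" for s
    using assms(4) that by (auto simp: eps_quotient_witness_def)
  have iso: "lmc_isomorphism (quotient_lmc N U) Q h"
    using assms(4) by (simp add: eps_quotient_witness_def Let_def N_def U_def)
  have N: "is_lmc N"
    using assms(2) w(1) by (auto simp: is_lmc_def N_def)
  have U: "prob_bisimulation N U"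
    unfolding U_def using fin by (intro prob_bisimulation_prob_bisimilarity) (simp add: fields)
  have class_state: "U `` {s} \<in> states (quotient_lmc N U)" if "s \<in> states M'" for s
    using that by (simp add: quotient_lmc_def fields quotientI)
  have gQ: "g s \<in> states Q" if "s \<in> states M'" for s
    using iso class_state[OF that] by (auto simp: g_def lmc_isomorphism_def bij_betw_def)
  have label_g: "label Q (g s) = label M' s" if "s \<in> states M'" for s
    using iso class_state[OF that] label_quotient[OF U, of s] that
    by (simp add: g_def lmc_isomorphism_def fields)
  \<comment> \<open>Since \<open>g\<close> is \<open>h\<close> after the class map, passing to the
    quotient and then renaming is a single pushforward along \<open>g\<close>.\<close>
  have trans_g: "transition Q (g s) = map_pmf g (\<tau>' s)" if "s \<in> states M'" for s
    using iso class_state[OF that] transition_quotient_eq_map[OF N U, of s] that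
    by (simp add: g_def[abs_def] lmc_isomorphism_def fields pmf.map_comp o_def)
  have "\<exists>\<omega>\<in>couplings (map_pmf Inl (transition M' s)) (map_pmf Inr (transition Q (g s))).
      1 - \<epsilon>\<^sub>2 / 2 \<le> measure_pmf.prob \<omega> R" if s: "s \<in> states M'" for s
  proof -
    have "set_pmf (transition M' s) \<subseteq> states M'" using assms(2) s by (simp add: is_lmc_def)
    from maximal_coupling[OF fin this w(1)[OF s]] obtain \<omega> where
      \<omega>: "\<omega> \<in> couplings (transition M' s) (\<tau>' s)" "set_pmf \<omega> \<subseteq> states M' \<times> states M'"
        "1 - (\<Sum>x\<in>states M'. \<bar>pmf (\<tau>' s) x - pmf (transition M' s) x\<bar>) / 2
          \<le> measure_pmf.prob \<omega> {(x, y). x = y}"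
      by blast
    \<comment> \<open>\<open>?k\<close> sends a diagonal pair \<open>(x, x)\<close> to
      \<open>(Inl x, Inr (g x))\<close>, which lies in \<open>R\<close> when \<open>x\<close> is a
      state.\<close>
    let ?k = "\<lambda>(x, y). (Inl x, Inr (g y)) :: ('s + 'q) \<times> ('s + 'q)"
    have "1 - \<epsilon>\<^sub>2 / 2 \<le> measure_pmf.prob \<omega> {(x, y). x = y}"
      using \<omega>(3) w(2)[OF s] by linarith
    also have "\<dots> = measure_pmf.prob \<omega> ({(x, y). x = y} \<inter> set_pmf \<omega>)"
      by (simp add: measure_Int_set_pmf)
    \<comment> \<open>Only an inequality: a pair of distinct states with the same image under
      \<open>g\<close> is also sent into \<open>R\<close>.\<close>
    also have "\<dots> \<le> measure_pmf.prob \<omega> (?k -` R)"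
      using \<omega>(2) by (intro measure_pmf.finite_measure_mono) (auto simp: R_def)
    finally have "1 - \<epsilon>\<^sub>2 / 2 \<le> measure_pmf.prob (map_pmf ?k \<omega>) R" by simp
    moreover have "map_pmf ?k \<omega> \<in>
        couplings (map_pmf Inl (transition M' s)) (map_pmf Inr (transition Q (g s)))"
    proof -
      have "map_pmf fst (map_pmf ?k \<omega>) = map_pmf Inl (map_pmf fst \<omega>)"
        "map_pmf snd (map_pmf ?k \<omega>) = map_pmf Inr (map_pmf g (map_pmf snd \<omega>))"
        by (simp_all add: pmf.map_comp o_def case_prod_beta)
      then show ?thesis
        using \<omega>(1) by (simp add: couplings_def trans_g[OF s])
    qed
    ultimately show ?thesis by blast
  qed
  then have "eps_bisimulation (\<epsilon>\<^sub>2 / 2) (direct_sum M' Q) R"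
    using gQ label_g by (auto simp: eps_bisimulation_def direct_sum_def R_def)
  then show ?thesis
    by (auto simp: eps_bisimilar_def g R_def)
qed

end
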